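(* The left $U_\lambda$-module $\Gamma_\lambda\cong\mathbf{R}$ (with $U_\lambda$ acting on $\mathbf{R}=R^G\subset\Omega$ by restricting its defining action on $\Omega$) is faithful, i.e. the only $u\in U_\lambda$ with $u\cdot f=0$ for all $f\in\mathbf R$ is $u=0$.
   Context: Let $k\ge 1$ and let $\lambda=(\lambda_1,\dots,\lambda_k)$ be positive integers. Let $I$ be the set of pairs $(i,j)$ with $1\le i\le k$, $1\le j\le \lambda_i$; for $1\le i\le k$ let $I^{(i)}=\{(i,j):1\le j\le\lambda_i\}$, and put $I^{(0)}=\emptyset$ (a product over the empty set is $1$). Let $\Omega=\mathbb{C}(x_{\mathbf a}:\mathbf a\in I)$ and $R=\mathbb{C}[x_{\mathbf a}:\mathbf a\in I]\subset\Omega$. For $\mathbf a\in I$, $\varphi_{\mathbf a}$ is the $\mathbb{C}$-automorphism of the field $\Omega$ with $\varphi_{\mathbf a}(x_{\mathbf b})=x_{\mathbf b}+\delta_{\mathbf a,\mathbf b}$. Elements of $\Omega$ act on $\Omega$ by multiplication. For $i=1,\dots,k-1$ define operators on $\Omega$ $$E_i=\sum_{j=1}^{\lambda_i}\frac{\prod_{\mathbf a\in I^{(i+1)}}(x_{(i,j)}-x_{\mathbf a})}{\prod_{\mathbf b\in I^{(i)}\setminus\{(i,j)\}}(x_{(i,j)}-x_{\mathbf b})}\varphi_{(i,j)},\qquad F_i=\sum_{j=1}^{\lambda_i}\frac{\prod_{\mathbf a\in I^{(i-1)}}(x_{(i,j)}-x_{\mathbf a})}{\prod_{\mathbf b\in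 I^{(i)}\setminus\{(i,j)\}}(x_{(i,j)}-x_{\mathbf b})}\varphi_{(i,j)}^{-1}.$$ For $\mathbf a=(i,j)\in I$, $\gamma_{\mathbf a}$ is multiplication by the $j$-th elementary symmetric polynomial in $\{x_{\mathbf b}:\mathbf b\in I^{(i)}\}$. The orthogonal Gelfand-Zeitlin algebra $U_\lambda$ is the algebra of $\mathbb{C}$-linear transformations of $\Omega$ generated by all $E_i,F_i$ ($1\le i\le k-1$) and all $\gamma_{\mathbf a}$ ($\mathbf a\in I$). Its Gelfand-Zeitlin subalgebra $\Gamma_\lambda$ is generated by all $\gamma_{\mathbf a}$. The group $G=S_{\lambda_1}\times\dots\times S_{\lambda_k}$ acts on $\Omega$ and $R$, with $S_{\lambda_i}$ permuting $x_{(i,1)},\dots,x_{(i,\lambda_i)}$; $\mathbf{R}:=R^G$ is identified with $\Gamma_\lambda$ ($f\in\mathbf R$ corresponds to multiplication by $f$). The subspace $\mathbf R\subset\Omega$ is stable under $U_\lambda$; this makes $\Gamma_\lambda=\mathbf R$ a left $U_\lambda$-module extending the left regular action of $\Gamma_\lambda$. *)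

theory Defs
  imports
    Complex_Main
    "HOL-Library.FuncSet"
    "HOL-Library.Poly_Mapping"
    "HOL-Library.Product_Lexorder"
    "HOL-Combinatorics.Permutations"
    "HOL-Computational_Algebra.Fraction_Field"
begin

section \<open>Polynomials and rational functions in doubly indexed variables\<close>

text \<open>
  The types below have one variable for every pair of natural numbers. The ring and the field
  in the finitely many variables indexed by a set \<open>A\<close> are the subsets \<open>poly_ring A\<close> and
  \<open>rat_field A\<close>. The lexicographic order on pairs only serves to obtain the \<open>idom\<close> instance
  for polynomials.
\<close>

type_synonym idx = "nat \<times> nat"
type_synonym cpoly = "(idx \<Rightarrow>\<^sub>0 nat) \<Rightarrow>\<^sub>0 complex"
type_synonym ratfun = "cpoly fract"

definition pconst :: "complex \<Rightarrow> cpoly" where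
  "pconst c = Poly_Mapping.single 0 c"

definition pvar :: "idx \<Rightarrow> cpoly" where
  "pvar a = Poly_Mapping.single (Poly_Mapping.single a 1) 1"

definition poly_ring :: "idx set \<Rightarrow> cpoly set" where
  "poly_ring A = {p. \<forall>m \<in> Poly_Mapping.keys p. Poly_Mapping.keys m \<subseteq> A}"

definition rat_field :: "idx set \<Rightarrow> ratfun set" where
  "rat_field A = {Fract p q | p q. p \<in> poly_ring A \<and> q \<in> poly_ring A \<and> q \<noteq> 0}"

definition rconst :: "complex \<Rightarrow> ratfun" where
  "rconst c = Fract (pconst c) 1"

definition rvar :: "idx \<Rightarrow> ratfun" where
  "rvar a = Fract (pvar a) 1"


subsection \<open>Substitution\<close>

definition mon_subst :: "(idx \<Rightarrow> cpoly) \<Rightarrow> (idx \<Rightarrow>\<^sub>0 nat) \<Rightarrow> cpoly" where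
  "mon_subst s m = (\<Prod>a \<in> Poly_Mapping.keys m. s a ^ Poly_Mapping.lookup m a)"

definition poly_subst :: "(idx \<Rightarrow> cpoly) \<Rightarrow> cpoly \<Rightarrow> cpoly" where
  "poly_subst s p =
     (\<Sum>m \<in> Poly_Mapping.keys p. pconst (Poly_Mapping.lookup p m) * mon_subst s m)"

lemma pconst_0 [simp]: "pconst 0 = 0"
  and pconst_1 [simp]: "pconst 1 = 1"
  and pconst_add: "pconst (c + d) = pconst c + pconst d"
  and pconst_mult: "pconst (c * d) = pconst c * pconst d"
  by (simp_all add: pconst_def single_add mult_single)

lemma mon_subst_superset:
  assumes "finite A" "Poly_Mapping.keys m \<subseteq> A"
  shows "mon_subst s m = (\<Prod>a \<in> A. s a ^ Poly_Mapping.lookup m a)"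
  unfolding mon_subst_def using assms
  by (intro prod.mono_neutral_left) (auto simp: in_keys_iff)

lemma mon_subst_0 [simp]: "mon_subst s 0 = 1"
  by (simp add: mon_subst_def)

lemma mon_subst_add: "mon_subst s (m + n) = mon_subst s m * mon_subst s n"
proof -
  let ?A = "Poly_Mapping.keys m \<union> Poly_Mapping.keys n"
  have "mon_subst s (m + n) = (\<Prod>a \<in> ?A. s a ^ Poly_Mapping.lookup (m + n) a)"
    by (rule mon_subst_superset) (use keys_add[of m n] in auto)
  also have "\<dots> = (\<Prod>a \<in> ?A. s a ^ Poly_Mapping.lookup m a) * (\<Prod>a \<in> ?A. s a ^ Poly_Mapping.lookup n a)"
    by (simp add: lookup_add power_add prod.distrib)
  also have "\<dots> = mon_subst s m * mon_subst s n"
    by (simp add: mon_subst_superset[of ?A m] mon_subst_superset[of ?A n])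
  finally show ?thesis .
qed

lemma poly_subst_superset:
  assumes "finite A" "Poly_Mapping.keys p \<subseteq> A"
  shows "poly_subst s p = (\<Sum>m \<in> A. pconst (Poly_Mapping.lookup p m) * mon_subst s m)"
  unfolding poly_subst_def using assms
  by (intro sum.mono_neutral_left) (auto simp: in_keys_iff)

lemma poly_subst_0 [simp]: "poly_subst s 0 = 0"
  by (simp add: poly_subst_def)

lemma poly_subst_add: "poly_subst s (p + q) = poly_subst s p + poly_subst s q"
proof -
  let ?A = "Poly_Mapping.keys p \<union> Poly_Mapping.keys q"
  have "poly_subst s (p + q) =
      (\<Sum>m \<in> ?A. pconst (Poly_Mapping.lookup (p + q) m) * mon_subst s m)"
    by (rule poly_subst_superset) (use keys_add[of p q] in auto)
  also have "\<dots> = (\<Sum>m \<in> ?A. pconst (Poly_Mapping.lookup p m) * mon_subst s m)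
      + (\<Sum>m \<in> ?A. pconst (Poly_Mapping.lookup q m) * mon_subst s m)"
    by (simp add: lookup_add pconst_add distrib_right sum.distrib)
  also have "\<dots> = poly_subst s p + poly_subst s q"
    by (simp add: poly_subst_superset[of ?A p] poly_subst_superset[of ?A q])
  finally show ?thesis .
qed

lemma poly_subst_sum: "poly_subst s (sum f A) = (\<Sum>x \<in> A. poly_subst s (f x))"
  by (induction A rule: infinite_finite_induct) (simp_all add: poly_subst_add)

lemma poly_subst_single:
  "poly_subst s (Poly_Mapping.single m c) = pconst c * mon_subst s m"
  by (simp add: poly_subst_def)

lemma poly_subst_pconst [simp]: "poly_subst s (pconst c) = pconst c"
  by (simp add: poly_subst_single pconst_def[of c])

lemma poly_subst_1 [simp]: "poly_subst s 1 = 1"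
  using poly_subst_pconst[of s 1] by simp

lemma poly_subst_pvar [simp]: "poly_subst s (pvar a) = s a"
  by (simp add: poly_subst_single pvar_def mon_subst_def)

lemma sum_singles:
  fixes p :: "'a \<Rightarrow>\<^sub>0 'b :: comm_monoid_add"
  shows "p = (\<Sum>m \<in> Poly_Mapping.keys p. Poly_Mapping.single m (Poly_Mapping.lookup p m))"
  by (rule poly_mapping_eqI)
     (auto simp: lookup_sum lookup_single when_def in_keys_iff)

lemma poly_subst_mult: "poly_subst s (p * q) = poly_subst s p * poly_subst s q"
proof -
  let ?l = "Poly_Mapping.lookup"
  have "p * q = (\<Sum>m \<in> Poly_Mapping.keys p. Poly_Mapping.single m (?l p m)) *
      (\<Sum>n \<in> Poly_Mapping.keys q. Poly_Mapping.single n (?l q n))"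
    using sum_singles[of p] sum_singles[of q] by simp
  also have "\<dots> = (\<Sum>m \<in> Poly_Mapping.keys p. \<Sum>n \<in> Poly_Mapping.keys q.
      Poly_Mapping.single (m + n) (?l p m * ?l q n))"
    by (simp add: sum_product mult_single)
  finally have "poly_subst s (p * q) = (\<Sum>m \<in> Poly_Mapping.keys p. \<Sum>n \<in> Poly_Mapping.keys q.
      (pconst (?l p m) * mon_subst s m) * (pconst (?l q n) * mon_subst s n))"
    by (simp add: poly_subst_sum poly_subst_single pconst_mult mon_subst_add mult_ac)
  then show ?thesis
    by (simp add: poly_subst_def sum_product)
qed

lemma poly_subst_power: "poly_subst s (p ^ n) = poly_subst s p ^ n"
  by (induction n) (simp_all add: poly_subst_mult)

lemma poly_subst_prod: "poly_subst s (prod f A) = (\<Prod>x \<in> A. poly_subst s (f x))"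
  by (induction A rule: infinite_finite_induct) (simp_all add: poly_subst_mult)

lemma poly_subst_poly_subst:
  "poly_subst t (poly_subst s p) = poly_subst (\<lambda>a. poly_subst t (s a)) p"
  by (simp add: poly_subst_def[of s p] poly_subst_def[of "\<lambda>a. poly_subst t (s a)" p]
      mon_subst_def poly_subst_sum poly_subst_mult poly_subst_prod poly_subst_power)

lemma pvar_power: "pvar a ^ n = Poly_Mapping.single (Poly_Mapping.single a n) 1"
  by (induction n) (simp_all add: pvar_def mult_single flip: single_add)

lemma mon_subst_pvar: "mon_subst pvar m = Poly_Mapping.single m 1"
proof -
  have "(\<Prod>a \<in> A. Poly_Mapping.single (f a) (1 :: complex)) = Poly_Mapping.single (sum f A) 1"
    for f :: "idx \<Rightarrow> (idx \<Rightarrow>\<^sub>0 nat)" and A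
    by (induction A rule: infinite_finite_induct) (simp_all add: mult_single)
  then show ?thesis
    by (simp add: mon_subst_def pvar_power flip: sum_singles)
qed

lemma poly_subst_ident [simp]: "poly_subst pvar p = p"
  by (simp add: poly_subst_def mon_subst_pvar pconst_def mult_single flip: sum_singles)


subsection \<open>The shift automorphisms\<close>

definition pshift :: "idx \<Rightarrow> complex \<Rightarrow> cpoly \<Rightarrow> cpoly" where
  "pshift a c = poly_subst (\<lambda>b. pvar b + (if b = a then pconst c else 0))"

lemma pshift_pshift: "pshift a c (pshift a d p) = pshift a (c + d) p"
proof -
  have "poly_subst (\<lambda>b. pvar b + (if b = a then pconst c else 0))
      (pvar b + (if b = a then pconst d else 0)) =
      pvar b + (if b = a then pconst (c + d) else 0)" for b
    by (auto simp: poly_subst_add pconst_add)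
  then show ?thesis
    by (simp add: pshift_def poly_subst_poly_subst)
qed

lemma pshift_0 [simp]: "pshift a 0 p = p"
proof -
  have "(\<lambda>b. pvar b + (if b = a then pconst 0 else 0)) = pvar"
    by auto
  then show ?thesis
    by (simp only: pshift_def poly_subst_ident)
qed

lemma pshift_1 [simp]: "pshift a c 1 = 1"
  by (simp add: pshift_def)

lemma pshift_eq_0_iff [simp]: "pshift a c p = 0 \<longleftrightarrow> p = 0"
proof
  assume "pshift a c p = 0"
  then have "pshift a (- c) (pshift a c p) = 0"
    by (simp add: pshift_def)
  then show "p = 0" by (simp add: pshift_pshift)
qed (simp add: pshift_def)

lemma pshift_mult: "pshift a c (p * q) = pshift a c p * pshift a c q"
  by (simp add: pshift_def poly_subst_mult)

lemma pshift_add: "pshift a c (p + q) = pshift a c p + pshift a c q"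
  by (simp add: pshift_def poly_subst_add)

lift_definition shift :: "idx \<Rightarrow> complex \<Rightarrow> ratfun \<Rightarrow> ratfun"
  is "\<lambda>a c (p, q). (pshift a c p, pshift a c q)"
  by (auto simp flip: pshift_mult)

lemma shift_Fract: "shift a c (Fract p q) = Fract (pshift a c p) (pshift a c q)"
  by transfer auto

lemma shift_add: "shift a c (f + g) = shift a c f + shift a c g"
  by (cases f; cases g) (simp add: shift_Fract pshift_add pshift_mult)

lemma shift_mult: "shift a c (f * g) = shift a c f * shift a c g"
  by (cases f; cases g) (simp add: shift_Fract pshift_mult)

lemma shift_rconst: "shift a c (rconst d) = rconst d"
  by (simp add: rconst_def shift_Fract pshift_def)

lemma shift_rvar: "shift a c (rvar b) = rvar b + (if b = a then rconst c else 0)"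
  by (auto simp: rvar_def rconst_def shift_Fract pshift_def poly_subst_add)

lemma shift_shift: "shift a c (shift a d f) = shift a (c + d) f"
  by (cases f) (simp add: shift_Fract pshift_pshift)

lemma shift_0: "shift a 0 f = f"
  by (cases f) (simp add: shift_Fract)

definition phi :: "idx \<Rightarrow> ratfun \<Rightarrow> ratfun" where
  "phi a = shift a 1"

definition phi_inv :: "idx \<Rightarrow> ratfun \<Rightarrow> ratfun" where
  "phi_inv a = shift a (- 1)"

lemma phi_inv_phi: "phi_inv a (phi a f) = f" and phi_phi_inv: "phi a (phi_inv a f) = f"
  by (simp_all add: phi_def phi_inv_def shift_shift shift_0)


section \<open>The orthogonal Gelfand-Zeitlin algebra\<close>

definition row :: "nat \<Rightarrow> (nat \<Rightarrow> nat) \<Rightarrow> nat \<Rightarrow> idx set" where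
  "row k lam i = {(i, j) | j. 1 \<le> i \<and> i \<le> k \<and> 1 \<le> j \<and> j \<le> lam i}"

definition Idx :: "nat \<Rightarrow> (nat \<Rightarrow> nat) \<Rightarrow> idx set" where
  "Idx k lam = {(i, j). 1 \<le> i \<and> i \<le> k \<and> 1 \<le> j \<and> j \<le> lam i}"

definition Omega :: "nat \<Rightarrow> (nat \<Rightarrow> nat) \<Rightarrow> ratfun set" where
  "Omega k lam = rat_field (Idx k lam)"

text \<open>
  Operators on \<open>\<Omega>\<close> are extensional functions on \<open>Omega k lam\<close>, so that two of them are equal in
  HOL iff they agree on \<open>\<Omega>\<close>.
\<close>

definition E_op :: "nat \<Rightarrow> (nat \<Rightarrow> nat) \<Rightarrow> nat \<Rightarrow> ratfun \<Rightarrow> ratfun" where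
  "E_op k lam i = (\<lambda>f \<in> Omega k lam. \<Sum>j = 1..lam i.
     (\<Prod>a \<in> row k lam (i + 1). rvar (i, j) - rvar a) /
     (\<Prod>b \<in> row k lam i - {(i, j)}. rvar (i, j) - rvar b) * phi (i, j) f)"

definition F_op :: "nat \<Rightarrow> (nat \<Rightarrow> nat) \<Rightarrow> nat \<Rightarrow> ratfun \<Rightarrow> ratfun" where
  "F_op k lam i = (\<lambda>f \<in> Omega k lam. \<Sum>j = 1..lam i.
     (\<Prod>a \<in> row k lam (i - 1). rvar (i, j) - rvar a) /
     (\<Prod>b \<in> row k lam i - {(i, j)}. rvar (i, j) - rvar b) * phi_inv (i, j) f)"

definition elem_sym :: "idx set \<Rightarrow> nat \<Rightarrow> ratfun" where
  "elem_sym A j = (\<Sum>S | S \<subseteq> A \<and> card S = j. \<Prod>b \<in> S. rvar b)"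

definition gamma_op :: "nat \<Rightarrow> (nat \<Rightarrow> nat) \<Rightarrow> idx \<Rightarrow> ratfun \<Rightarrow> ratfun" where
  "gamma_op k lam a = (\<lambda>f \<in> Omega k lam. elem_sym (row k lam (fst a)) (snd a) * f)"

text \<open>The unital algebra of operators on \<open>V\<close> generated by a set of operators.\<close>

inductive_set generated_algebra ::
    "ratfun set \<Rightarrow> (ratfun \<Rightarrow> ratfun) set \<Rightarrow> (ratfun \<Rightarrow> ratfun) set"
  for V :: "ratfun set" and S :: "(ratfun \<Rightarrow> ratfun) set" where
  gen: "u \<in> S \<Longrightarrow> u \<in> generated_algebra V S"
| one: "(\<lambda>f \<in> V. f) \<in> generated_algebra V S"
| scale: "u \<in> generated_algebra V S \<Longrightarrow> (\<lambda>f \<in> V. rconst c * u f) \<in> generated_algebra V S"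
| add: "u \<in> generated_algebra V S \<Longrightarrow> v \<in> generated_algebra V S \<Longrightarrow>
    (\<lambda>f \<in> V. u f + v f) \<in> generated_algebra V S"
| mult: "u \<in> generated_algebra V S \<Longrightarrow> v \<in> generated_algebra V S \<Longrightarrow>
    compose V u v \<in> generated_algebra V S"

definition U_alg :: "nat \<Rightarrow> (nat \<Rightarrow> nat) \<Rightarrow> (ratfun \<Rightarrow> ratfun) set" where
  "U_alg k lam = generated_algebra (Omega k lam)
     (E_op k lam ` {1..<k} \<union> F_op k lam ` {1..<k} \<union> gamma_op k lam ` Idx k lam)"

text \<open>
  The product of the symmetric groups of the rows, as the group of permutations of the index
  set that preserve each row.
\<close>

definition G_grp :: "nat \<Rightarrow> (nat \<Rightarrow> nat) \<Rightarrow> (idx \<Rightarrow> idx) set" where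
  "G_grp k lam = {\<sigma>. \<sigma> permutes Idx k lam \<and> (\<forall>a \<in> Idx k lam. fst (\<sigma> a) = fst a)}"

definition perm_act :: "(idx \<Rightarrow> idx) \<Rightarrow> cpoly \<Rightarrow> cpoly" where
  "perm_act \<sigma> = poly_subst (\<lambda>a. pvar (\<sigma> a))"

definition R_inv :: "nat \<Rightarrow> (nat \<Rightarrow> nat) \<Rightarrow> ratfun set" where
  "R_inv k lam =
     {Fract p 1 | p. p \<in> poly_ring (Idx k lam) \<and> (\<forall>\<sigma> \<in> G_grp k lam. perm_act \<sigma> p = p)}"

end

theory Submission
  imports Defs "HOL-Computational_Algebra.Polynomial"
begin

text \<open>
  Every operator in \<open>U_alg k lam\<close> is a finite sum \<open>\<Sum>d. c d \<cdot> \<tau>\<^sub>d\<close>, where \<open>\<tau>\<^sub>d\<close> is the translation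
  automorphism \<open>x\<^sub>a \<mapsto> x\<^sub>a + d a\<close> and the coefficients \<open>c d\<close> are rational functions: the
  generators have this form, and such sums are closed under composition because
  \<open>\<tau>\<^sub>d \<circ> (c \<cdot> \<tau>\<^sub>e) = \<tau>\<^sub>d c \<cdot> \<tau>\<^sub>d\<^sub>+\<^sub>e\<close> (lemmas \<open>U_alg_subset_difference_operators\<close> and
  \<open>difference_operators_compose\<close>).

  A sum of this kind is determined by its values on the powers of one symmetric polynomial, the
  sum of squares \<open>f = \<Sum>a. x\<^sub>a\<^sup>2\<close>. The linear part of \<open>\<tau>\<^sub>d f\<close> is \<open>\<Sum>a. 2 d\<^sub>a x\<^sub>a\<close>, so the elements
  \<open>\<tau>\<^sub>d f\<close> are pairwise distinct (lemma \<open>translate_sum_squares_inj\<close>). If \<open>u\<close> kills all powers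
  \<open>f\<^sup>n\<close>, then \<open>\<Sum>d. c d \<cdot> (\<tau>\<^sub>d f)\<^sup>n = 0\<close> for every \<open>n\<close>, and the invertibility of the Vandermonde
  matrix of the \<open>\<tau>\<^sub>d f\<close> (lemma \<open>vandermonde_kernel\<close>) forces all \<open>c d\<close> to vanish. As \<open>f\<close> and its
  powers are invariant under every permutation of the variables, they lie in \<open>R_inv k lam\<close>,
  which gives faithfulness.
\<close>

section \<open>Independence of geometric sequences\<close>

text \<open>
  By linearity the hypothesis holds with any polynomial in place of the powers; a polynomial
  vanishing at all the points but one isolates the corresponding coefficient.
\<close>

lemma vandermonde_kernel:
  fixes c t :: "'d \<Rightarrow> 'a :: field"
  assumes T: "finite T" and inj: "inj_on t T"
    and zero: "\<And>n. (\<Sum>d\<in>T. c d * t d ^ n) = 0"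
    and e: "e \<in> T"
  shows "c e = 0"
proof -
  have poly_zero: "(\<Sum>d\<in>T. c d * poly p (t d)) = 0" for p
  proof -
    have "(\<Sum>d\<in>T. c d * poly p (t d)) = (\<Sum>d\<in>T. \<Sum>i\<le>degree p. coeff p i * (c d * t d ^ i))"
      by (simp add: poly_altdef sum_distrib_left mult_ac)
    also have "\<dots> = (\<Sum>i\<le>degree p. coeff p i * (\<Sum>d\<in>T. c d * t d ^ i))"
      by (subst sum.swap) (simp add: sum_distrib_left)
    also have "\<dots> = 0"
      by (simp add: zero)
    finally show ?thesis .
  qed
  define p where "p = (\<Prod>d\<in>T - {e}. [:- t d, 1:])"
  have "poly p (t d) = 0" if "d \<in> T - {e}" for d
    using that T by (auto simp: p_def poly_prod)
  then have "(\<Sum>d\<in>T. c d * poly p (t d)) = c e * poly p (t e)"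
    using T e by (simp add: sum.remove)
  moreover have "poly p (t e) \<noteq> 0"
    using T e inj by (auto simp: p_def poly_prod inj_on_def)
  ultimately show ?thesis
    using poly_zero[of p] by simp
qed


section \<open>Closure properties of polynomials and rational functions in given variables\<close>

lemma poly_ring_0 [simp]: "0 \<in> poly_ring A"
  and poly_ring_pconst [simp]: "pconst c \<in> poly_ring A"
  and poly_ring_1 [simp]: "1 \<in> poly_ring A"
  by (auto simp: poly_ring_def pconst_def)

lemma poly_ring_pvar [simp]: "a \<in> A \<Longrightarrow> pvar a \<in> poly_ring A"
  by (auto simp: poly_ring_def pvar_def)

lemma poly_ring_add: "p \<in> poly_ring A \<Longrightarrow> q \<in> poly_ring A \<Longrightarrow> p + q \<in> poly_ring A"
  using keys_add[of p q] by (auto simp: poly_ring_def)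

lemma poly_ring_mult:
  assumes "p \<in> poly_ring A" "q \<in> poly_ring A"
  shows "p * q \<in> poly_ring A"
  unfolding poly_ring_def
proof safe
  fix m a b assume m: "m \<in> Poly_Mapping.keys (p * q)" and ab: "(a, b) \<in> Poly_Mapping.keys m"
  from m obtain m1 m2 where "m = m1 + m2" "m1 \<in> Poly_Mapping.keys p" "m2 \<in> Poly_Mapping.keys q"
    using keys_mult[of p q] by blast
  with ab keys_add[of m1 m2] assms show "(a, b) \<in> A"
    by (auto simp: poly_ring_def)
qed

lemma poly_ring_sum: "(\<And>j. j \<in> J \<Longrightarrow> f j \<in> poly_ring A) \<Longrightarrow> sum f J \<in> poly_ring A"
  by (induction J rule: infinite_finite_induct) (auto intro: poly_ring_add)

lemma poly_ring_prod: "(\<And>j. j \<in> J \<Longrightarrow> f j \<in> poly_ring A) \<Longrightarrow> prod f J \<in> poly_ring A"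
  by (induction J rule: infinite_finite_induct) (auto intro: poly_ring_mult)

lemma poly_ring_power: "p \<in> poly_ring A \<Longrightarrow> p ^ n \<in> poly_ring A"
  by (induction n) (auto intro: poly_ring_mult)

lemma poly_ring_poly_subst:
  assumes "p \<in> poly_ring A" and "\<And>a. a \<in> A \<Longrightarrow> s a \<in> poly_ring B"
  shows "poly_subst s p \<in> poly_ring B"
  unfolding poly_subst_def mon_subst_def
  by (intro poly_ring_sum poly_ring_mult poly_ring_prod poly_ring_power poly_ring_pconst assms(2))
     (use assms(1) in \<open>unfold poly_ring_def, blast\<close>)

lemma rat_field_Fract:
  "p \<in> poly_ring A \<Longrightarrow> q \<in> poly_ring A \<Longrightarrow> q \<noteq> 0 \<Longrightarrow> Fract p q \<in> rat_field A"
  by (auto simp: rat_field_def)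

lemma rat_field_of_poly: "p \<in> poly_ring A \<Longrightarrow> Fract p 1 \<in> rat_field A"
  by (simp add: rat_field_Fract)

lemma rat_fieldE:
  assumes "f \<in> rat_field A"
  obtains p q where "f = Fract p q" "p \<in> poly_ring A" "q \<in> poly_ring A" "q \<noteq> 0"
  using assms by (auto simp: rat_field_def)

lemma rat_field_rconst [simp]: "rconst c \<in> rat_field A"
  and rat_field_0 [simp]: "0 \<in> rat_field A"
  and rat_field_1 [simp]: "1 \<in> rat_field A"
  by (simp_all add: rconst_def Zero_fract_def One_fract_def rat_field_of_poly)

lemma rat_field_rvar: "a \<in> A \<Longrightarrow> rvar a \<in> rat_field A"
  by (simp add: rvar_def rat_field_of_poly)

lemma rat_field_add: "f \<in> rat_field A \<Longrightarrow> g \<in> rat_field A \<Longrightarrow> f + g \<in> rat_field A"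
  by (elim rat_fieldE) (auto intro!: rat_field_Fract poly_ring_add poly_ring_mult)

lemma rat_field_mult: "f \<in> rat_field A \<Longrightarrow> g \<in> rat_field A \<Longrightarrow> f * g \<in> rat_field A"
  by (elim rat_fieldE) (auto intro!: rat_field_Fract poly_ring_mult)

lemma rat_field_diff:
  assumes "f \<in> rat_field A" "g \<in> rat_field A"
  shows "f - g \<in> rat_field A"
proof -
  have "rconst (- 1) = - 1"
    by (simp add: rconst_def pconst_def single_uminus One_fract_def flip: minus_fract)
  then have "f - g = f + rconst (- 1) * g"
    by simp
  then show ?thesis
    using assms by (simp only: rat_field_add rat_field_mult rat_field_rconst)
qed

lemma rat_field_divide:
  assumes "f \<in> rat_field A" "g \<in> rat_field A"
  shows "f / g \<in> rat_field A"
proof (cases "g = 0")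
  case False
  from assms(2) obtain p q where g: "g = Fract p q" "p \<in> poly_ring A" "q \<in> poly_ring A" "q \<noteq> 0"
    by (rule rat_fieldE)
  with False have "p \<noteq> 0"
    by (auto simp: fract_collapse)
  with g have "inverse g \<in> rat_field A"
    by (auto intro: rat_field_Fract)
  with assms(1) show ?thesis
    by (simp add: divide_inverse rat_field_mult)
qed simp

lemma rat_field_sum: "(\<And>j. j \<in> J \<Longrightarrow> f j \<in> rat_field A) \<Longrightarrow> sum f J \<in> rat_field A"
  by (induction J rule: infinite_finite_induct) (auto intro: rat_field_add)

lemma rat_field_prod: "(\<And>j. j \<in> J \<Longrightarrow> f j \<in> rat_field A) \<Longrightarrow> prod f J \<in> rat_field A"
  by (induction J rule: infinite_finite_induct) (auto intro: rat_field_mult)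


section \<open>Translations\<close>

definition ptranslate :: "(idx \<Rightarrow> complex) \<Rightarrow> cpoly \<Rightarrow> cpoly" where
  "ptranslate d = poly_subst (\<lambda>b. pvar b + pconst (d b))"

lemma ptranslate_ptranslate: "ptranslate d (ptranslate e p) = ptranslate (\<lambda>b. d b + e b) p"
  by (simp add: ptranslate_def poly_subst_poly_subst poly_subst_add pconst_add add_ac)

lemma ptranslate_0 [simp]: "ptranslate (\<lambda>_. 0) p = p"
  by (simp add: ptranslate_def)

lemma ptranslate_eq_0_iff [simp]: "ptranslate d p = 0 \<longleftrightarrow> p = 0"
proof
  assume "ptranslate d p = 0"
  then have "ptranslate (\<lambda>b. - d b) (ptranslate d p) = 0"
    by (simp add: ptranslate_def)
  then show "p = 0"
    by (simp add: ptranslate_ptranslate)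
qed (simp add: ptranslate_def)

lemma ptranslate_add: "ptranslate d (p + q) = ptranslate d p + ptranslate d q"
  and ptranslate_mult: "ptranslate d (p * q) = ptranslate d p * ptranslate d q"
  and ptranslate_zero [simp]: "ptranslate d 0 = 0"
  and ptranslate_1 [simp]: "ptranslate d 1 = 1"
  by (simp_all add: ptranslate_def poly_subst_add poly_subst_mult)

lemma ptranslate_in_poly_ring: "p \<in> poly_ring A \<Longrightarrow> ptranslate d p \<in> poly_ring A"
  unfolding ptranslate_def by (rule poly_ring_poly_subst) (auto intro: poly_ring_add)

lift_definition translate :: "(idx \<Rightarrow> complex) \<Rightarrow> ratfun \<Rightarrow> ratfun"
  is "\<lambda>d (p, q). (ptranslate d p, ptranslate d q)"
  by (auto simp flip: ptranslate_mult)

lemma translate_Fract: "translate d (Fract p q) = Fract (ptranslate d p) (ptranslate d q)"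
  by transfer auto

lemma translate_add: "translate d (f + g) = translate d f + translate d g"
  by (cases f; cases g) (simp add: translate_Fract ptranslate_add ptranslate_mult)

lemma translate_mult: "translate d (f * g) = translate d f * translate d g"
  by (cases f; cases g) (simp add: translate_Fract ptranslate_mult)

lemma translate_zero [simp]: "translate d 0 = 0"
  by (simp add: Zero_fract_def translate_Fract)

lemma translate_one [simp]: "translate d 1 = 1"
  by (simp add: One_fract_def translate_Fract)

lemma translate_sum: "translate d (sum f J) = (\<Sum>j\<in>J. translate d (f j))"
  by (induction J rule: infinite_finite_induct) (simp_all add: translate_add)

lemma translate_power: "translate d (f ^ n) = translate d f ^ n"
  by (induction n) (simp_all add: translate_mult)

lemma translate_translate: "translate d (translate e f) = translate (\<lambda>b. d b + e b) f"
  by (cases f) (simp add: translate_Fract ptranslate_ptranslate)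

lemma translate_0 [simp]: "translate (\<lambda>_. 0) f = f"
  by (cases f) (simp add: translate_Fract)

lemma shift_eq_translate: "shift a c = translate (\<lambda>b. if b = a then c else 0)"
proof
  fix f
  have "pshift a c = ptranslate (\<lambda>b. if b = a then c else 0)"
    unfolding pshift_def ptranslate_def by (rule arg_cong[of _ _ poly_subst]) auto
  then show "shift a c f = translate (\<lambda>b. if b = a then c else 0) f"
    by (cases f) (simp add: shift_Fract translate_Fract)
qed

lemma translate_in_rat_field: "f \<in> rat_field A \<Longrightarrow> translate d f \<in> rat_field A"
  by (elim rat_fieldE) (auto simp: translate_Fract intro!: rat_field_Fract ptranslate_in_poly_ring)


section \<open>The sum of squares separates translations\<close>

definition sum_squares :: "idx set \<Rightarrow> cpoly" where
  "sum_squares A = (\<Sum>a\<in>A. pvar a ^ 2)"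

lemma sum_squares_in_poly_ring: "sum_squares A \<in> poly_ring A"
  unfolding sum_squares_def by (intro poly_ring_sum poly_ring_power poly_ring_pvar)

lemma perm_act_sum_squares:
  assumes "\<sigma> permutes A"
  shows "perm_act \<sigma> (sum_squares A) = sum_squares A"
proof -
  have "perm_act \<sigma> (sum_squares A) = (\<Sum>a\<in>A. pvar (\<sigma> a) ^ 2)"
    by (simp add: perm_act_def sum_squares_def poly_subst_sum poly_subst_power)
  also have "\<dots> = sum_squares A"
    unfolding sum_squares_def
    using sum.permute[OF assms, of "\<lambda>a. pvar a ^ 2"] by (simp only: comp_def)
  finally show ?thesis .
qed

text \<open>The coefficient of the linear monomial \<open>x\<^sub>b\<close> recovers the translation in that coordinate.\<close>

lemma lookup_ptranslate_sum_squares: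
  assumes "finite A" "b \<in> A"
  shows "Poly_Mapping.lookup (ptranslate d (sum_squares A)) (Poly_Mapping.single b 1) = 2 * d b"
proof -
  have square: "(pvar a + pconst c) ^ 2 =
      Poly_Mapping.single (Poly_Mapping.single a 2) 1 +
      Poly_Mapping.single (Poly_Mapping.single a 1) (2 * c) + Poly_Mapping.single 0 (c ^ 2)"
    for a :: idx and c :: complex
  proof -
    have "(pvar a + pconst c) ^ 2 = pvar a ^ 2 + (pvar a * pconst c + pvar a * pconst c) + pconst c * pconst c"
      by (simp add: power2_eq_square algebra_simps)
    then show ?thesis
      unfolding pvar_power
      by (simp add: pvar_def pconst_def mult_single power2_eq_square flip: single_add)
  qed
  have neq: "Poly_Mapping.single a 2 \<noteq> Poly_Mapping.single b (1 :: nat)"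
            "0 \<noteq> Poly_Mapping.single b (1 :: nat)" for a :: idx
    by (metis lookup_single_eq lookup_single_not_eq one_neq_zero zero_neq_numeral
        numeral_eq_one_iff semiring_norm(85))
       (metis lookup_single_eq lookup_zero one_neq_zero)
  have inj: "Poly_Mapping.single a (1 :: nat) = Poly_Mapping.single b 1 \<longleftrightarrow> a = b" for a :: idx
    by (metis lookup_single_eq lookup_single_not_eq one_neq_zero)
  have "Poly_Mapping.lookup (ptranslate d (sum_squares A)) (Poly_Mapping.single b 1) =
      (\<Sum>a\<in>A. if a = b then 2 * d a else 0)"
    unfolding ptranslate_def sum_squares_def poly_subst_sum poly_subst_power poly_subst_pvar
      lookup_sum square
    by (intro sum.cong) (use neq inj in \<open>simp_all add: lookup_add lookup_single when_def\<close>)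
  with assms show ?thesis
    by simp
qed

lemma translate_sum_squares_inj:
  assumes "finite A"
  shows "inj_on (\<lambda>d. translate d (Fract (sum_squares A) 1)) {d. \<forall>b. b \<notin> A \<longrightarrow> d b = 0}"
proof (rule inj_onI; rule ext)
  fix d e b
  assume d: "d \<in> {d. \<forall>b. b \<notin> A \<longrightarrow> d b = 0}" and e: "e \<in> {d. \<forall>b. b \<notin> A \<longrightarrow> d b = 0}"
    and eq: "translate d (Fract (sum_squares A) 1) = translate e (Fract (sum_squares A) 1)"
  from eq have "ptranslate d (sum_squares A) = ptranslate e (sum_squares A)"
    by (simp add: translate_Fract eq_fract)
  then have "d b = e b" if "b \<in> A"
    using lookup_ptranslate_sum_squares[OF assms that] by (metis mult_cancel_left zero_neq_numeral)
  moreover have "d b = e b" if "b \<notin> A"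
    using d e that by (simp del: split_paired_All)
  ultimately show "d b = e b"
    by blast
qed


section \<open>Difference operators\<close>

text \<open>
  The shift vectors vanish outside \<open>A\<close>, so that different vectors give different automorphisms of
  \<open>rat_field A\<close>. The coefficients lie in \<open>rat_field A\<close>, so that the operators preserve it.
\<close>

definition difference_operators :: "idx set \<Rightarrow> (ratfun \<Rightarrow> ratfun) set" where
  "difference_operators A = {\<lambda>f\<in>rat_field A. \<Sum>d\<in>T. c d * translate d f | T c.
     finite T \<and> (\<forall>d\<in>T. (\<forall>b. b \<notin> A \<longrightarrow> d b = 0) \<and> c d \<in> rat_field A)}"

lemma difference_operatorsE:
  assumes "u \<in> difference_operators A"
  obtains T c where "u = (\<lambda>f\<in>rat_field A. \<Sum>d\<in>T. c d * translate d f)" "finite T"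
    "\<And>d b. d \<in> T \<Longrightarrow> b \<notin> A \<Longrightarrow> d b = 0" "\<And>d. d \<in> T \<Longrightarrow> c d \<in> rat_field A"
  using assms unfolding difference_operators_def by blast

lemma difference_operators_maps:
  assumes "u \<in> difference_operators A" "f \<in> rat_field A"
  shows "u f \<in> rat_field A"
  using assms(1) by (rule difference_operatorsE)
    (use assms(2) in \<open>auto intro!: rat_field_sum rat_field_mult translate_in_rat_field\<close>)

lemma difference_operators_monomial:
  assumes "\<And>b. b \<notin> A \<Longrightarrow> d b = 0" "c \<in> rat_field A"
  shows "(\<lambda>f\<in>rat_field A. c * translate d f) \<in> difference_operators A"
  unfolding difference_operators_def
  by (rule CollectI, rule exI[of _ "{d}"], rule exI[of _ "\<lambda>_. c"]) (use assms in auto)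

lemma difference_operators_add:
  assumes "u \<in> difference_operators A" "v \<in> difference_operators A"
  shows "(\<lambda>f\<in>rat_field A. u f + v f) \<in> difference_operators A"
proof -
  from assms(1) obtain S a where S: "u = (\<lambda>f\<in>rat_field A. \<Sum>d\<in>S. a d * translate d f)" "finite S"
    "\<And>d b. d \<in> S \<Longrightarrow> b \<notin> A \<Longrightarrow> d b = 0" "\<And>d. d \<in> S \<Longrightarrow> a d \<in> rat_field A"
    by (rule difference_operatorsE) blast
  from assms(2) obtain T c where T: "v = (\<lambda>f\<in>rat_field A. \<Sum>d\<in>T. c d * translate d f)" "finite T"
    "\<And>d b. d \<in> T \<Longrightarrow> b \<notin> A \<Longrightarrow> d b = 0" "\<And>d. d \<in> T \<Longrightarrow> c d \<in> rat_field A"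
    by (rule difference_operatorsE) blast
  define w where "w d = (if d \<in> S then a d else 0) + (if d \<in> T then c d else 0)" for d
  have "(\<Sum>d\<in>S \<union> T. w d * translate d f) =
      (\<Sum>d\<in>S. a d * translate d f) + (\<Sum>d\<in>T. c d * translate d f)" for f
  proof -
    have "(\<Sum>d\<in>S. a d * translate d f) = (\<Sum>d\<in>S \<union> T. (if d \<in> S then a d else 0) * translate d f)"
      using S(2) T(2) by (intro sum.mono_neutral_cong_left) auto
    moreover have
      "(\<Sum>d\<in>T. c d * translate d f) = (\<Sum>d\<in>S \<union> T. (if d \<in> T then c d else 0) * translate d f)"
      using S(2) T(2) by (intro sum.mono_neutral_cong_left) auto
    ultimately show ?thesis
      by (simp add: w_def distrib_right sum.distrib)
  qed
  then have "(\<lambda>f\<in>rat_field A. u f + v f) =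
      (\<lambda>f\<in>rat_field A. \<Sum>d\<in>S \<union> T. w d * translate d f)"
    by (auto simp: S(1) T(1))
  moreover have "finite (S \<union> T)"
      "\<forall>d\<in>S \<union> T. (\<forall>b. b \<notin> A \<longrightarrow> d b = 0) \<and> w d \<in> rat_field A"
    using S T by (auto simp: w_def intro: rat_field_add)
  ultimately show ?thesis
    unfolding difference_operators_def by blast
qed

lemma difference_operators_sum:
  assumes "finite J" "\<And>j. j \<in> J \<Longrightarrow> (\<lambda>f\<in>rat_field A. u j f) \<in> difference_operators A"
  shows "(\<lambda>f\<in>rat_field A. \<Sum>j\<in>J. u j f) \<in> difference_operators A"
  using assms
proof (induction J rule: finite_induct)
  case empty
  have "(\<lambda>f\<in>rat_field A. 0 * translate (\<lambda>_. 0) f) \<in> difference_operators A"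
    by (rule difference_operators_monomial) simp_all
  then show ?case
    by (simp only: sum.empty mult_zero_left)
next
  case (insert j J)
  then have "(\<lambda>f\<in>rat_field A. (\<lambda>f\<in>rat_field A. u j f) f + (\<lambda>f\<in>rat_field A. \<Sum>j\<in>J. u j f) f)
      \<in> difference_operators A"
    by (intro difference_operators_add) auto
  also have "(\<lambda>f\<in>rat_field A. (\<lambda>f\<in>rat_field A. u j f) f + (\<lambda>f\<in>rat_field A. \<Sum>j\<in>J. u j f) f) =
      (\<lambda>f\<in>rat_field A. \<Sum>j\<in>insert j J. u j f)"
    using insert.hyps by (auto simp: fun_eq_iff)
  finally show ?case .
qed

text \<open>Moving a coefficient \<open>c e\<close> to the left past \<open>\<tau>\<^sub>d\<close> turns it into \<open>\<tau>\<^sub>d (c e)\<close>.\<close>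

lemma difference_operators_compose:
  assumes "u \<in> difference_operators A" "v \<in> difference_operators A"
  shows "compose (rat_field A) u v \<in> difference_operators A"
proof -
  from assms(1) obtain S a where S: "u = (\<lambda>f\<in>rat_field A. \<Sum>d\<in>S. a d * translate d f)" "finite S"
    "\<And>d b. d \<in> S \<Longrightarrow> b \<notin> A \<Longrightarrow> d b = 0" "\<And>d. d \<in> S \<Longrightarrow> a d \<in> rat_field A"
    by (rule difference_operatorsE) blast
  from assms(2) obtain T c where T: "v = (\<lambda>f\<in>rat_field A. \<Sum>d\<in>T. c d * translate d f)" "finite T"
    "\<And>d b. d \<in> T \<Longrightarrow> b \<notin> A \<Longrightarrow> d b = 0" "\<And>d. d \<in> T \<Longrightarrow> c d \<in> rat_field A"
    by (rule difference_operatorsE) blast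
  have "u (v f) =
      (\<Sum>d\<in>S. \<Sum>e\<in>T. (a d * translate d (c e)) * translate (\<lambda>b. d b + e b) f)"
    if "f \<in> rat_field A" for f
  proof -
    have "u (v f) = (\<Sum>d\<in>S. a d * translate d (v f))"
      using difference_operators_maps[OF assms(2) that] by (simp add: S(1))
    then show ?thesis
      using that
      by (simp add: T(1) translate_sum translate_mult translate_translate sum_distrib_left mult.assoc)
  qed
  then have "compose (rat_field A) u v = (\<lambda>f\<in>rat_field A.
      \<Sum>d\<in>S. \<Sum>e\<in>T. (a d * translate d (c e)) * translate (\<lambda>b. d b + e b) f)"
    by (simp add: compose_def cong: restrict_cong)
  also have "\<dots> \<in> difference_operators A"
    by (intro difference_operators_sum difference_operators_monomial rat_field_mult
        translate_in_rat_field S(2,4) T(2,4)) (metis S(3) T(3) add_0_left)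
  finally show ?thesis .
qed

lemma generated_algebra_subset:
  assumes "S \<subseteq> difference_operators A"
  shows "generated_algebra (rat_field A) S \<subseteq> difference_operators A"
proof
  have mult_op: "(\<lambda>f\<in>rat_field A. g * f) \<in> difference_operators A" if "g \<in> rat_field A" for g
    using difference_operators_monomial[of A "\<lambda>_. 0" g] that by simp
  fix u
  assume "u \<in> generated_algebra (rat_field A) S"
  then show "u \<in> difference_operators A"
  proof induction
    case (gen u)
    with assms show ?case by blast
  next
    case one
    have "(\<lambda>f\<in>rat_field A. 1 * f) \<in> difference_operators A"
      by (rule mult_op) simp
    then show ?case by (simp only: mult_1_left)
  next
    case (scale u c)
    from mult_op[of "rconst c"] scale.IH
    have "compose (rat_field A) (\<lambda>f\<in>rat_field A. rconst c * f) u \<in> difference_operators A"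
      by (intro difference_operators_compose) auto
    also have "compose (rat_field A) (\<lambda>f\<in>rat_field A. rconst c * f) u =
        (\<lambda>f\<in>rat_field A. rconst c * u f)"
      using difference_operators_maps[OF scale.IH] by (auto simp: compose_def fun_eq_iff)
    finally show ?case .
  next
    case (add u v)
    show ?case by (rule difference_operators_add[OF add.IH])
  next
    case (mult u v)
    show ?case by (rule difference_operators_compose[OF mult.IH])
  qed
qed

lemma difference_operator_eq_0:
  assumes "finite A" and u: "u \<in> difference_operators A"
    and zero: "\<And>n. u (Fract (sum_squares A) 1 ^ n) = 0"
  shows "u = (\<lambda>f\<in>rat_field A. 0)"
proof -
  let ?f = "Fract (sum_squares A) 1"
  from u obtain T c where T: "u = (\<lambda>f\<in>rat_field A. \<Sum>d\<in>T. c d * translate d f)" "finite T"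
    "\<And>d b. d \<in> T \<Longrightarrow> b \<notin> A \<Longrightarrow> d b = 0" "\<And>d. d \<in> T \<Longrightarrow> c d \<in> rat_field A"
    by (rule difference_operatorsE) blast
  have "?f ^ n \<in> rat_field A" for n
    by (induction n) (auto intro: rat_field_mult rat_field_of_poly sum_squares_in_poly_ring)
  then have "(\<Sum>d\<in>T. c d * translate d ?f ^ n) = 0" for n
    using zero[of n] by (simp add: T(1) translate_power)
  moreover have "inj_on (\<lambda>d. translate d ?f) T"
    using translate_sum_squares_inj[OF assms(1)] by (rule inj_on_subset) (use T(3) in auto)
  ultimately have "c d = 0" if "d \<in> T" for d
    using vandermonde_kernel[OF T(2), of "\<lambda>d. translate d ?f" c d] that by blast
  then show ?thesis
    by (simp add: T(1) cong: restrict_cong)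
qed


section \<open>Faithfulness\<close>

lemma finite_Idx: "finite (Idx k lam)"
proof -
  have "Idx k lam = (SIGMA i:{1..k}. {1..lam i})"
    by (auto simp: Idx_def)
  then show ?thesis by simp
qed

lemma row_subset_Idx: "row k lam i \<subseteq> Idx k lam"
  by (auto simp: row_def Idx_def)

lemma U_alg_subset_difference_operators: "U_alg k lam \<subseteq> difference_operators (Idx k lam)"
proof -
  let ?I = "Idx k lam"
  have coeff: "(\<Prod>a \<in> row k lam i'. rvar b - rvar a) / (\<Prod>a \<in> row k lam i - {b}. rvar b - rvar a)
      \<in> rat_field ?I" if "b \<in> ?I" for i i' b
    using that row_subset_Idx[of k lam]
    by (intro rat_field_divide rat_field_prod rat_field_diff rat_field_rvar) auto
  have sum_shifts: "(\<lambda>f\<in>rat_field ?I. \<Sum>j = 1..lam i.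
      (\<Prod>a \<in> row k lam i'. rvar (i, j) - rvar a) /
      (\<Prod>b \<in> row k lam i - {(i, j)}. rvar (i, j) - rvar b) * shift (i, j) c f)
      \<in> difference_operators ?I" if "i \<in> {1..<k}" for i i' c
    unfolding shift_eq_translate using that
    by (intro difference_operators_sum difference_operators_monomial coeff) (auto simp: Idx_def)
  have "elem_sym (row k lam i) j \<in> rat_field ?I" for i j
    unfolding elem_sym_def using row_subset_Idx[of k lam]
    by (intro rat_field_sum rat_field_prod rat_field_rvar) blast
  then have "gamma_op k lam a \<in> difference_operators ?I" for a
    using difference_operators_monomial[of ?I "\<lambda>_. 0" "elem_sym (row k lam (fst a)) (snd a)"]
    by (simp add: gamma_op_def Omega_def)
  then show ?thesis
    unfolding U_alg_def Omega_def using sum_shifts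
    by (intro generated_algebra_subset)
       (auto simp: E_op_def F_op_def phi_def phi_inv_def Omega_def)
qed

lemma sum_squares_power_in_R_inv: "Fract (sum_squares (Idx k lam)) 1 ^ n \<in> R_inv k lam"
proof -
  have "Fract p 1 ^ n = Fract (p ^ n) 1" for p :: cpoly
    by (induction n) (simp_all add: One_fract_def)
  moreover have "perm_act \<sigma> (sum_squares (Idx k lam) ^ n) = sum_squares (Idx k lam) ^ n"
    if "\<sigma> \<in> G_grp k lam" for \<sigma>
    using perm_act_sum_squares[of \<sigma> "Idx k lam"] that
    by (simp add: G_grp_def perm_act_def poly_subst_power)
  ultimately show ?thesis
    unfolding R_inv_def using poly_ring_power[OF sum_squares_in_poly_ring] by auto
qed

theorem corollary3:
  fixes k :: nat and lam :: "nat \<Rightarrow> nat"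
  assumes "k \<ge> 1" and "\<And>i. 1 \<le> i \<Longrightarrow> i \<le> k \<Longrightarrow> lam i \<ge> 1"
  shows "\<forall>u \<in> U_alg k lam. (\<forall>f \<in> R_inv k lam. u f = 0) \<longrightarrow> u = (\<lambda>f \<in> Omega k lam. 0)"
proof (intro ballI impI)
  fix u
  assume u: "u \<in> U_alg k lam" and zero: "\<forall>f \<in> R_inv k lam. u f = 0"
  from u have "u \<in> difference_operators (Idx k lam)"
    using U_alg_subset_difference_operators by blast
  then show "u = (\<lambda>f \<in> Omega k lam. 0)"
    unfolding Omega_def
    by (rule difference_operator_eq_0[OF finite_Idx])
       (use zero sum_squares_power_in_R_inv in blast)
qed

end
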